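(* Let $\kappa_3$ be an arbitrary parameter. For $\beta\in\mathbb{C}$ consider the non-abelian system (with $z$ a central parameter) $$\frac{du}{dt}=-u^2+v-\tfrac12z,\qquad\frac{dv}{dt}=2vu+\beta[v,u]+\kappa_3 .$$ There are exactly two values of $\beta$ for which this system has a non-abelian first integral of the form $$J=a_1u^2v+(-1-a_1-a_2)uvu+a_2vu^2+\tfrac12v^2-\kappa_3u-\tfrac12zv$$ for some coefficients $a_1,a_2$ independent of $u,v,z$, namely $\beta=-2$ (so that $dv/dt=2uv+\kappa_3$) and $\beta=0$ (so that $dv/dt=2vu+\kappa_3$).
   Context: "Arbitrary parameter" means that $\kappa_3$ is an indeterminate over $\mathbb{C}$; let $K$ be an algebraic closure of $\mathbb{C}(\kappa_3)$, in which $a_1,a_2$ lie. The variables $u,v$ are generators of the free unital associative algebra $\mathcal{A}=K[z]\langle u,v\rangle$, $z$ is a central indeterminate, and $[x,y]=xy-yx$. A system $du/dt=F_1,\ dv/dt=F_2$ denotes the $K[z]$-linear derivation $d_t$ of $\mathcal{A}$ with $d_t(u)=F_1$, $d_t(v)=F_2$. An element $J\in\mathcal{A}$ is a non-abelian first integral if $d_t(J)=0$ in $\mathcal{A}$. (The system is the auxiliary autonomous system of a non-abelian Painlevé-2 system, obtained by replacing $d/dz$ by $d/dt$ and regarding $z$ as a parameter.) *)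

theory Defs
  imports "HOL-Algebra.Algebraic_Closure_Type" "HOL-Library.Poly_Mapping"
begin

datatype 'g free_monoid = Free_Monoid (letters: "'g list")

instantiation free_monoid :: (type) monoid_add
begin

definition zero_free_monoid :: "'a free_monoid" where
  "0 = Free_Monoid []"

definition plus_free_monoid :: "'a free_monoid \<Rightarrow> 'a free_monoid \<Rightarrow> 'a free_monoid" where
  "x + y = Free_Monoid (letters x @ letters y)"

instance
  by standard (simp_all add: zero_free_monoid_def plus_free_monoid_def)

end

text \<open>
  The free unital associative algebra is the monoid algebra of the free monoid: finitely
  supported functions from words to coefficients, with the convolution product of
  \<^theory>\<open>HOL-Library.Poly_Mapping\<close>, which does not require a commutative key monoid.
\<close>

type_synonym ('g, 'r) free_algebra = "'g free_monoid \<Rightarrow>\<^sub>0 'r"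

definition generator :: "'g \<Rightarrow> ('g, 'r::comm_ring_1) free_algebra" where
  "generator g = Poly_Mapping.single (Free_Monoid [g]) 1"

definition scalar :: "'r \<Rightarrow> ('g, 'r::comm_ring_1) free_algebra" where
  "scalar c = Poly_Mapping.single 0 c"

definition linear_derivation ::
    "(('g, 'r::comm_ring_1) free_algebra \<Rightarrow> ('g, 'r) free_algebra) \<Rightarrow> bool" where
  "linear_derivation D \<longleftrightarrow>
     (\<forall>x y. D (x + y) = D x + D y) \<and>
     (\<forall>c x. D (scalar c * x) = scalar c * D x) \<and>
     (\<forall>x y. D (x * y) = D x * y + x * D y)"

text \<open>Well-defined by the lemma \<open>ex1_linear_derivation\<close> below.\<close>

definition derivation_of ::
    "('g \<Rightarrow> ('g, 'r::comm_ring_1) free_algebra) \<Rightarrow> ('g, 'r) free_algebra \<Rightarrow> ('g, 'r) free_algebra"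
  where
  "derivation_of F = (THE D. linear_derivation D \<and> (\<forall>g. D (generator g) = F g))"

primrec word_derivation ::
    "('g \<Rightarrow> ('g, 'r::comm_ring_1) free_algebra) \<Rightarrow> 'g list \<Rightarrow> ('g, 'r) free_algebra" where
  "word_derivation F [] = 0"
| "word_derivation F (g # w) =
     F g * Poly_Mapping.single (Free_Monoid w) 1 + generator g * word_derivation F w"

lemma single_Free_Monoid_append:
  "Poly_Mapping.single (Free_Monoid (v @ w)) (1 :: 'r::comm_ring_1) =
     Poly_Mapping.single (Free_Monoid v) 1 * Poly_Mapping.single (Free_Monoid w) 1"
  by (simp add: mult_single plus_free_monoid_def)

lemma single_Free_Monoid_Nil: "Poly_Mapping.single (Free_Monoid []) (1 :: 'r::comm_ring_1) = 1"
  by (simp flip: zero_free_monoid_def)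

lemma single_eq_scalar_mult:
  "Poly_Mapping.single w c = scalar c * Poly_Mapping.single w (1 :: 'r::comm_ring_1)"
  by (simp add: scalar_def mult_single)

lemma scalar_add: "scalar (a + b) = scalar a + scalar b"
  by (simp add: scalar_def single_add)

lemma scalar_mult: "scalar (a * b) = scalar a * scalar b"
  by (simp add: scalar_def mult_single)

lemma free_algebra_induct [case_names zero single add]:
  fixes x :: "('g, 'r::comm_ring_1) free_algebra"
  assumes "P 0" and "\<And>w c. P (Poly_Mapping.single w c)"
    and "\<And>x y. P x \<Longrightarrow> P y \<Longrightarrow> P (x + y)"
  shows "P x"
proof -
  have "x = (\<Sum>w\<in>Poly_Mapping.keys x. Poly_Mapping.single w (Poly_Mapping.lookup x w))"
    by (rule poly_mapping_eqI)
      (auto simp: lookup_sum lookup_single when_def in_keys_iff)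
  moreover have "P (\<Sum>w\<in>A. Poly_Mapping.single w (Poly_Mapping.lookup x w))" for A
    by (induction A rule: infinite_finite_induct) (auto intro: assms)
  ultimately show ?thesis
    by metis
qed

lemma scalar_commute:
  fixes x :: "('g, 'r::comm_ring_1) free_algebra"
  shows "x * scalar c = scalar c * x"
  by (induction x rule: free_algebra_induct)
    (simp_all add: scalar_def mult_single algebra_simps)

lemma word_derivation_append:
  fixes F :: "'g \<Rightarrow> ('g, 'r::comm_ring_1) free_algebra"
  shows "word_derivation F (v @ w) =
    word_derivation F v * Poly_Mapping.single (Free_Monoid w) 1 +
    Poly_Mapping.single (Free_Monoid v) 1 * word_derivation F w"
proof (induction v)
  case Nil
  show ?case
    by (simp add: single_Free_Monoid_Nil)
next
  case (Cons g v)
  have "Poly_Mapping.single (Free_Monoid (g # v)) (1 :: 'r) =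
      generator g * Poly_Mapping.single (Free_Monoid v) 1"
    using single_Free_Monoid_append[of "[g]" v] by (simp add: generator_def)
  then show ?case
    by (simp add: Cons single_Free_Monoid_append algebra_simps)
qed

lemma ex_linear_derivation:
  fixes F :: "'g \<Rightarrow> ('g, 'r::comm_ring_1) free_algebra"
  shows "\<exists>D. linear_derivation D \<and> (\<forall>g. D (generator g) = F g)"
proof -
  define D where "D x = (\<Sum>w\<in>Poly_Mapping.keys x.
      scalar (Poly_Mapping.lookup x w) * word_derivation F (letters w))"
    for x :: "('g, 'r) free_algebra"
  have D_superset: "D x = (\<Sum>w\<in>A.
      scalar (Poly_Mapping.lookup x w) * word_derivation F (letters w))"
    if "finite A" "Poly_Mapping.keys x \<subseteq> A" for x A
    unfolding D_def using that
    by (intro sum.mono_neutral_left) (auto simp: in_keys_iff scalar_def)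
  have D_add: "D (x + y) = D x + D y" for x y
  proof -
    let ?A = "Poly_Mapping.keys x \<union> Poly_Mapping.keys y"
    have "Poly_Mapping.keys (x + y) \<subseteq> ?A"
      by (rule keys_add)
    then show ?thesis
      by (simp add: D_superset[of ?A] lookup_add scalar_add distrib_right sum.distrib)
  qed
  have D_single: "D (Poly_Mapping.single w c) = scalar c * word_derivation F (letters w)" for w c
    by (subst D_superset[of "{w}"]) auto
  have D_0: "D 0 = 0"
    by (simp add: D_def)
  have D_scalar: "D (scalar c * x) = scalar c * D x" for c x
  proof (induction x rule: free_algebra_induct)
    case (single w d)
    have "scalar c * Poly_Mapping.single w d = Poly_Mapping.single w (c * d)"
      by (simp add: scalar_def mult_single)
    then show ?case
      by (simp add: D_single scalar_mult mult.assoc)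
  qed (simp_all add: D_0 D_add distrib_left)
  have D_mult_single: "D (Poly_Mapping.single v c * Poly_Mapping.single w d) =
      D (Poly_Mapping.single v c) * Poly_Mapping.single w d +
      Poly_Mapping.single v c * D (Poly_Mapping.single w d)" for v w c d
  proof -
    obtain v' w' where vw: "v = Free_Monoid v'" "w = Free_Monoid w'"
      by (cases v, cases w)
    let ?v = "Poly_Mapping.single v (1 :: 'r)" and ?w = "Poly_Mapping.single w (1 :: 'r)"
    let ?dv = "word_derivation F v'" and ?dw = "word_derivation F w'"
    have 1: "D (Poly_Mapping.single v c * Poly_Mapping.single w d) =
        scalar c * scalar d * (?dv * ?w + ?v * ?dw)"
      by (simp add: mult_single D_single vw plus_free_monoid_def word_derivation_append scalar_mult)
    have 2: "D (Poly_Mapping.single v c) * Poly_Mapping.single w d = scalar c * scalar d * (?dv * ?w)"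
    proof -
      have "D (Poly_Mapping.single v c) * Poly_Mapping.single w d =
          scalar c * ((?dv * scalar d) * ?w)"
        by (subst single_eq_scalar_mult[of w]) (simp add: D_single vw mult.assoc)
      then show ?thesis
        by (simp only: scalar_commute[of ?dv d] mult.assoc)
    qed
    have 3: "Poly_Mapping.single v c * D (Poly_Mapping.single w d) = scalar c * scalar d * (?v * ?dw)"
    proof -
      have "Poly_Mapping.single v c * D (Poly_Mapping.single w d) =
          scalar c * ((?v * scalar d) * ?dw)"
        by (subst single_eq_scalar_mult[of v]) (simp add: D_single vw mult.assoc)
      then show ?thesis
        by (simp only: scalar_commute[of ?v d] mult.assoc)
    qed
    show ?thesis
      by (simp add: 1 2 3 distrib_left)
  qed
  have D_mult_aux: "D (Poly_Mapping.single v c * y) =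
      D (Poly_Mapping.single v c) * y + Poly_Mapping.single v c * D y" for v c y
    by (induction y rule: free_algebra_induct)
      (simp_all add: D_0 D_mult_single D_add distrib_left algebra_simps)
  have D_mult: "D (x * y) = D x * y + x * D y" for x y
    by (induction x rule: free_algebra_induct)
      (simp_all add: D_0 D_mult_aux D_add distrib_right algebra_simps)
  have "D (generator g) = F g" for g
  proof -
    have "scalar (1 :: 'r) = (1 :: ('g, 'r) free_algebra)"
      by (simp add: scalar_def)
    then show ?thesis
      by (simp add: generator_def D_single single_Free_Monoid_Nil)
  qed
  with D_add D_scalar D_mult show ?thesis
    unfolding linear_derivation_def by blast
qed

lemma linear_derivation_unique:
  fixes D E :: "('g, 'r::comm_ring_1) free_algebra \<Rightarrow> ('g, 'r) free_algebra"
  assumes D: "linear_derivation D" and E: "linear_derivation E"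
    and gen: "\<And>g. D (generator g) = E (generator g)"
  shows "D = E"
proof
  have G_0: "G 0 = 0" and one: "G 1 = 0"
    if "linear_derivation G" for G :: "('g, 'r) free_algebra \<Rightarrow> ('g, 'r) free_algebra"
  proof -
    have "G (0 + 0) = G 0 + G 0" "G (1 * 1) = G 1 * 1 + 1 * G 1"
      using that unfolding linear_derivation_def by blast+
    then show "G 0 = 0" "G 1 = 0"
      by simp_all
  qed
  have word: "D (Poly_Mapping.single (Free_Monoid w) 1) = E (Poly_Mapping.single (Free_Monoid w) 1)"
    for w
  proof (induction w)
    case Nil
    then show ?case
      by (simp add: one D E single_Free_Monoid_Nil)
  next
    case (Cons g w)
    have "Poly_Mapping.single (Free_Monoid (g # w)) (1 :: 'r) =
        generator g * Poly_Mapping.single (Free_Monoid w) 1"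
      using single_Free_Monoid_append[of "[g]" w] by (simp add: generator_def)
    with Cons gen D E show ?case
      by (simp add: linear_derivation_def)
  qed
  show "D x = E x" for x
  proof (induction x rule: free_algebra_induct)
    case zero
    show ?case
      by (simp add: G_0 D E)
  next
    case (single w c)
    obtain w' where "w = Free_Monoid w'"
      by (cases w)
    moreover have "D (scalar c * y) = scalar c * D y" "E (scalar c * y) = scalar c * E y" for y
      using D E unfolding linear_derivation_def by blast+
    ultimately show ?case
      using word[of w'] by (metis single_eq_scalar_mult)
  next
    case (add x y)
    with D E show ?case
      by (simp add: linear_derivation_def)
  qed
qed

lemma ex1_linear_derivation:
  "\<exists>!D. linear_derivation D \<and> (\<forall>g. D (generator g) = F g)"
  using ex_linear_derivation[of F] linear_derivation_unique by metis

lemma derivation_of: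
  shows linear_derivation_derivation_of: "linear_derivation (derivation_of F)"
    and derivation_of_generator: "derivation_of F (generator g) = F g"
  using theI'[OF ex1_linear_derivation[of F]] unfolding derivation_of_def by blast+

text \<open>
  The inner polynomial variable of \<open>base_field\<close> is \<open>\<kappa>\<^sub>3\<close>; the polynomial variable of the
  coefficient ring of \<open>uv_algebra\<close> is \<open>z\<close>.
\<close>

type_synonym base_field = "complex poly fract alg_closure"

datatype uv = U | V

type_synonym uv_algebra = "(uv, base_field poly) free_algebra"

definition of_complex :: "complex \<Rightarrow> base_field" where
  "of_complex c = to_ac (to_fract [:c:])"

definition kappa3 :: base_field where
  "kappa3 = to_ac (to_fract [:0, 1:])"

definition const :: "base_field \<Rightarrow> uv_algebra" where
  "const a = scalar [:a:]"

definition zpar :: uv_algebra where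
  "zpar = scalar [:0, 1:]"

definition ugen :: uv_algebra where
  "ugen = generator U"

definition vgen :: uv_algebra where
  "vgen = generator V"

definition commutator :: "'a::ring \<Rightarrow> 'a \<Rightarrow> 'a" where
  "commutator x y = x * y - y * x"

definition rhs_u :: uv_algebra where
  "rhs_u = - (ugen ^ 2) + vgen - const (1 / 2) * zpar"

definition rhs_v :: "complex \<Rightarrow> uv_algebra" where
  "rhs_v \<beta> = 2 * vgen * ugen + const (of_complex \<beta>) * commutator vgen ugen + const kappa3"

definition d_t :: "complex \<Rightarrow> uv_algebra \<Rightarrow> uv_algebra" where
  "d_t \<beta> = derivation_of (\<lambda>g. case g of U \<Rightarrow> rhs_u | V \<Rightarrow> rhs_v \<beta>)"

definition first_integral :: "complex \<Rightarrow> uv_algebra \<Rightarrow> bool" where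
  "first_integral \<beta> J \<longleftrightarrow> d_t \<beta> J = 0"

definition J_ansatz :: "base_field \<Rightarrow> base_field \<Rightarrow> uv_algebra" where
  "J_ansatz a1 a2 =
     const a1 * ugen ^ 2 * vgen + const (- 1 - a1 - a2) * ugen * vgen * ugen
     + const a2 * vgen * ugen ^ 2 + const (1 / 2) * vgen ^ 2
     - const kappa3 * ugen - const (1 / 2) * zpar * vgen"

end

theory Submission
  imports Defs
begin

text \<open>
  Write \<open>p = 2 + \<beta>\<close> and \<open>q = - \<beta>\<close>, so that \<open>v' = p v u + q u v + \<kappa>\<^sub>3\<close>, and put
  \<open>b = - 1 - a\<^sub>1 - a\<^sub>2\<close>. Expanding \<open>d\<^sub>t J\<close> in the basis of words, the coefficient of \<open>vuv\<close>
  forces \<open>b = 0\<close>, that of \<open>uvv\<close> then forces \<open>a\<^sub>1 = - q / 2\<close>, and that of \<open>uuuv\<close> becomes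
  \<open>- q (q - 2) / 2\<close>. Both roots make all remaining coefficients vanish.
\<close>

abbreviation monomial :: "'g list \<Rightarrow> 'r \<Rightarrow> ('g, 'r::comm_ring_1) free_algebra" where
  "monomial w c \<equiv> Poly_Mapping.single (Free_Monoid w) c"

lemma monomial_mult: "monomial v c * monomial w d = monomial (v @ w) (c * d)"
  by (simp add: mult_single plus_free_monoid_def)

lemma scalar_eq_monomial: "scalar c = monomial [] c"
  by (simp add: scalar_def zero_free_monoid_def)

lemma generator_eq_monomial: "generator g = monomial [g] 1"
  by (simp add: generator_def)

lemma derivation_of_add: "derivation_of F (x + y) = derivation_of F x + derivation_of F y"
  using linear_derivation_derivation_of[of F] unfolding linear_derivation_def by blast

text \<open>Makes the derivation computable: it is specified only by its values on generators, while
  \<open>word_derivation\<close> unfolds by rewriting. The Leibniz rule peels off the first letter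
  of a word.\<close>

lemma derivation_of_monomial:
  fixes F :: "'g \<Rightarrow> ('g, 'r::comm_ring_1) free_algebra"
  shows "derivation_of F (monomial w c) = monomial [] c * word_derivation F w"
proof -
  have mult: "derivation_of F (x * y) = derivation_of F x * y + x * derivation_of F y"
    and scale: "derivation_of F (scalar c * x) = scalar c * derivation_of F x" for x y c
    using linear_derivation_derivation_of[of F] unfolding linear_derivation_def by blast+
  have "derivation_of F (monomial w 1) = word_derivation F w"
  proof (induction w)
    case Nil
    show ?case
      \<comment> \<open>Leibniz on \<open>1 * 1\<close> gives D 1 = D 1 + D 1, so D 1 = 0.\<close>
      using mult[of 1 1] by (simp add: single_Free_Monoid_Nil)
  next
    case (Cons g w)
    have "monomial (g # w) (1 :: 'r) = generator g * monomial w 1"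
      by (simp add: generator_eq_monomial monomial_mult)
    with Cons show ?case
      by (simp add: mult derivation_of_generator)
  qed
  with scale show ?thesis
    by (metis single_eq_scalar_mult scalar_eq_monomial)
qed

text \<open>Keeping the coefficients as variables makes this a pure expansion over words. Since K[z]
  is not a field, 1/2 enters as \<open>h\<close> with \<open>h + h = 1\<close>. The words
  \<open>[V]\<close> and \<open>[]\<close> drop out: half of v^2 cancels against \<open>- k\<close>
  u in the first, \<open>- k\<close> u against \<open>- (h * z)\<close> v in the second.\<close>

lemma derivation_of_quartic:
  fixes F :: "uv \<Rightarrow> (uv, 'r::comm_ring_1) free_algebra"
  assumes h: "h + h = 1" and pq: "p + q = 2"
    and U: "F U = monomial [U, U] (- 1) + monomial [V] 1 + monomial [] (- (h * z))"
    and V: "F V = monomial [V, U] p + monomial [U, V] q + monomial [] k"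
  shows "derivation_of F (monomial [U, U, V] a + monomial [U, V, U] b + monomial [V, U, U] c
        + monomial [V, V] h + monomial [U] (- k) + monomial [V] (- (h * z))) =
      monomial [U, U, U, V] (a * (q - 2)) + monomial [U, U, V, U] (a * p + b * (q - 1))
      + monomial [U, V, U, U] (b * (p - 1) + c * q) + monomial [V, U, U, U] (c * (p - 2))
      + monomial [U, V, V] (a + b + h * q) + monomial [V, U, V] (a + c + 1)
      + monomial [V, V, U] (b + c + h * p) + monomial [U, U] (k * (a + b + c + 1))
      + monomial [U, V] (- (h * z) * (2 * a + b + q)) + monomial [V, U] (- (h * z) * (b + 2 * c + p))"
    (is "?L = ?R")
proof -
  have hh: "h * x + h * x = x" for x
    using h by (metis distrib_right mult_1)
  have hpq: "h * p + h * q = 1"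
    using h pq by (metis distrib_left mult_2_right)
  \<comment> \<open>Coefficients are first left as plain sums of signed products.
    \<open>single_add\<close> then splits the right-hand side as well, and both sides become the
    same sum of single words up to reordering.\<close>
  have "?L = monomial [U, U, U, V] (- a + - a + a * q)
      + monomial [U, U, V, U] (a * p + - b + b * q)
      + monomial [U, V, U, U] (b * p + - b + c * q)
      + monomial [V, U, U, U] (c * p + - c + - c)
      + monomial [U, V, V] (a + b + h * q)
      + monomial [V, U, V] (a + c + h * p + h * q)
      + monomial [V, V, U] (b + c + h * p)
      + monomial [U, U] (a * k + b * k + c * k + k)
      + monomial [U, V] (- (a * (h * z)) + - (a * (h * z)) + - (b * (h * z)) + - (h * z * q))
      + monomial [V, U] (- (b * (h * z)) + - (c * (h * z)) + - (c * (h * z)) + - (h * z * p))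
      + monomial [V] (h * k + h * k + - k)
      + monomial [] (k * (h * z) + - (h * z * k))"
    by (simp only: derivation_of_add derivation_of_monomial U V word_derivation.simps
        generator_eq_monomial monomial_mult append.simps single_add distrib_left distrib_right
        mult_zero_right add_0_left add_0_right mult_1_right mult_1_left mult_minus_left mult_minus_right
        minus_minus ac_simps)
  also have "\<dots> = ?R"
  proof -
    have "- a + - a + a * q = a * (q - 2)" "c * p + - c + - c = c * (p - 2)"
      "a * p + - b + b * q = a * p + b * (q - 1)" "b * p + - b + c * q = b * (p - 1) + c * q"
      "a + c + h * p + h * q = a + c + 1" "a * k + b * k + c * k + k = k * (a + b + c + 1)"
      "- (a * (h * z)) + - (a * (h * z)) + - (b * (h * z)) + - (h * z * q) = - (h * z) * (2 * a + b + q)"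
      "- (b * (h * z)) + - (c * (h * z)) + - (c * (h * z)) + - (h * z * p) = - (h * z) * (b + 2 * c + p)"
      "h * k + h * k + - k = 0" "k * (h * z) + - (h * z * k) = 0"
      using hh[of k] hpq by (simp_all add: algebra_simps)
    then show ?thesis
      by (simp only: single_zero add_0_right)
  qed
  finally show ?thesis .
qed

text \<open>Constant polynomials, fractions and the algebraic closure are successive embeddings.
  Injectivity later turns equations in K back into equations for \<beta>.\<close>

lemma
  shows of_complex_0: "of_complex 0 = 0"
    and of_complex_1: "of_complex 1 = 1"
    and of_complex_uminus: "of_complex (- x) = - of_complex x"
    and of_complex_add: "of_complex (x + y) = of_complex x + of_complex y"
    and of_complex_eq_iff: "of_complex x = of_complex y \<longleftrightarrow> x = y"
  by (simp_all add: of_complex_def one_pCons[symmetric]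
      flip: to_fract_add to_ac_add to_fract_uminus to_ac_minus)

lemma of_complex_2: "of_complex 2 = 2"
  using of_complex_add[of 1 1] by (simp add: of_complex_1)

text \<open>Inherited from the complex numbers through the embedding; it is what makes
  \<open>1 / 2\<close> a genuine half in K.\<close>

lemma base_field_2_neq_0: "(2 :: base_field) \<noteq> 0"
  using of_complex_eq_iff[of 2 0] by (simp add: of_complex_0 of_complex_2)

lemma two_eq_monomial: "(2 :: ('g, 'r::comm_ring_1) free_algebra) = monomial [] 2"
proof -
  have "(2 :: ('g, 'r) free_algebra) = monomial [] 1 + monomial [] 1"
    by (simp add: single_Free_Monoid_Nil)
  then show ?thesis
    by (simp flip: single_add)
qed

lemma rhs_v_eq:
  "rhs_v \<beta> = monomial [V, U] [:2 + of_complex \<beta>:] + monomial [U, V] [:- of_complex \<beta>:]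
    + monomial [] [:kappa3:]"
proof -
  \<comment> \<open>Splitting the coefficients this way matches the expansion of 2vu + \<beta>(vu -
    uv) word by word.\<close>
  have "[:2 + of_complex \<beta>:] = 2 + [:of_complex \<beta>:]" "[:- of_complex \<beta>:] = - [:of_complex \<beta>:]"
    by (simp_all add: numeral_poly)
  then show ?thesis
    by (simp only: single_add single_uminus)
      (simp add: rhs_v_def commutator_def ugen_def vgen_def const_def generator_eq_monomial
        scalar_eq_monomial monomial_mult two_eq_monomial algebra_simps)
qed

text \<open>The generic expansion with coefficient ring K[z]. Its hypotheses become 1/2 + 1/2 = 1
  and (2 + \<beta>) - \<beta> = 2.\<close>

lemma d_t_J_ansatz:
  fixes \<beta> a1 a2
  defines "p \<equiv> [:2 + of_complex \<beta>:]" and "q \<equiv> [:- of_complex \<beta>:]"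
    and "a \<equiv> [:a1:]" and "b \<equiv> [:- 1 - a1 - a2:]" and "c \<equiv> [:a2:]"
    and "h \<equiv> [:1 / 2:]" and "z \<equiv> [:0, 1:]" and "k \<equiv> [:kappa3:]"
  shows "d_t \<beta> (J_ansatz a1 a2) =
      monomial [U, U, U, V] (a * (q - 2)) + monomial [U, U, V, U] (a * p + b * (q - 1))
      + monomial [U, V, U, U] (b * (p - 1) + c * q) + monomial [V, U, U, U] (c * (p - 2))
      + monomial [U, V, V] (a + b + h * q) + monomial [V, U, V] (a + c + 1)
      + monomial [V, V, U] (b + c + h * p) + monomial [U, U] (k * (a + b + c + 1))
      + monomial [U, V] (- (h * z) * (2 * a + b + q)) + monomial [V, U] (- (h * z) * (b + 2 * c + p))"
proof -
  have U: "rhs_u = monomial [U, U] (- 1) + monomial [V] 1 + monomial [] (- (h * z))"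
    by (simp add: rhs_u_def ugen_def vgen_def const_def zpar_def generator_eq_monomial
        scalar_eq_monomial monomial_mult power2_eq_square h_def z_def flip: single_uminus)
  have V: "rhs_v \<beta> = monomial [V, U] p + monomial [U, V] q + monomial [] k"
    by (simp add: rhs_v_eq p_def q_def k_def)
  have J: "J_ansatz a1 a2 = monomial [U, U, V] a + monomial [U, V, U] b + monomial [V, U, U] c
        + monomial [V, V] h + monomial [U] (- k) + monomial [V] (- (h * z))"
    by (simp add: J_ansatz_def ugen_def vgen_def const_def zpar_def generator_eq_monomial
        scalar_eq_monomial monomial_mult power2_eq_square a_def b_def c_def
        h_def z_def k_def flip: single_uminus)
  show ?thesis
    unfolding d_t_def J
    by (rule derivation_of_quartic)
      (simp_all add: U V h_def p_def q_def base_field_2_neq_0 flip: numeral_poly)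
qed

theorem proposition5:
  shows "{\<beta> :: complex. \<exists>a1 a2 :: base_field. first_integral \<beta> (J_ansatz a1 a2)} = {-2, 0}
    \<and> rhs_v (-2) = 2 * ugen * vgen + const kappa3
    \<and> rhs_v 0 = 2 * vgen * ugen + const kappa3"
proof (intro conjI)
  have neg2: "of_complex (- 2) = - 2"
    by (simp add: of_complex_uminus of_complex_2)
  show "rhs_v (-2) = 2 * ugen * vgen + const kappa3"
    by (simp add: rhs_v_eq neg2 ugen_def vgen_def const_def generator_eq_monomial
        scalar_eq_monomial monomial_mult two_eq_monomial flip: numeral_poly)
  show "rhs_v 0 = 2 * vgen * ugen + const kappa3"
    by (simp add: rhs_v_def const_def of_complex_0 scalar_def)
  show "{\<beta> :: complex. \<exists>a1 a2 :: base_field. first_integral \<beta> (J_ansatz a1 a2)} = {-2, 0}"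
  proof (intro equalityI subsetI)
    fix \<beta> :: complex
    assume "\<beta> \<in> {\<beta>. \<exists>a1 a2 :: base_field. first_integral \<beta> (J_ansatz a1 a2)}"
    then obtain a1 a2 where 0: "d_t \<beta> (J_ansatz a1 a2) = 0"
      by (auto simp: first_integral_def)
    have coeff: "Poly_Mapping.lookup (d_t \<beta> (J_ansatz a1 a2)) (Free_Monoid w) = 0" for w
      by (simp add: 0)
    \<comment> \<open>The three words read off here have coefficients free of \<open>z\<close>, so
      their vanishing gives equations in K itself.\<close>
    have UUUV: "a1 * (- of_complex \<beta> - 2) = 0"
      using coeff[of "[U, U, U, V]"]
      by (auto simp: d_t_J_ansatz lookup_add lookup_single numeral_poly)
    \<comment> \<open>\<open>a1\<close> cancels against the coefficient \<open>- 1 - a1 - a2\<close>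
      of uvu.\<close>
    have UVV: "- 1 - a2 + 1 / 2 * - of_complex \<beta> = 0"
      using coeff[of "[U, V, V]"]
      by (simp add: d_t_J_ansatz lookup_add lookup_single)
    have VUV: "a1 + a2 + 1 = 0"
      using coeff[of "[V, U, V]"]
      by (simp add: d_t_J_ansatz lookup_add lookup_single one_pCons)
    have "a1 = (a1 + a2 + 1) - 1 - a2"
      by simp
    then have "a1 = - 1 - a2"
      by (simp only: VUV diff_0)
    with UVV have "a1 = 1 / 2 * of_complex \<beta>"
      by simp
    \<comment> \<open>K has no zero divisors; zero is written \<open>of_complex 0\<close> so that
      injectivity applies to both alternatives.\<close>
    with UUUV have "of_complex \<beta> = of_complex 0 \<or> - of_complex \<beta> - 2 = 0"
      by (simp add: base_field_2_neq_0 of_complex_0)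
    then have "of_complex \<beta> = of_complex 0 \<or> of_complex \<beta> = of_complex (- 2)"
      unfolding neg2 by (auto simp: algebra_simps minus_equation_iff[of "of_complex \<beta>"])
    then show "\<beta> \<in> {-2, 0}"
      by (auto simp: of_complex_eq_iff)
  next
    fix \<beta> :: complex
    assume "\<beta> \<in> {-2, 0}"
    then consider "\<beta> = -2" | "\<beta> = 0"
      by blast
    then show "\<beta> \<in> {\<beta>. \<exists>a1 a2 :: base_field. first_integral \<beta> (J_ansatz a1 a2)}"
    proof cases
      case 1
      \<comment> \<open>Here p = 0 and q = 2, so a1 = -q/2 = -1, and b = 0 gives a2 = 0.\<close>
      have "d_t \<beta> (J_ansatz (- 1) 0) = 0"
        by (simp add: 1 d_t_J_ansatz neg2 base_field_2_neq_0 numeral_poly one_pCons)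
      then show ?thesis
        by (auto simp: first_integral_def)
    next
      case 2
      \<comment> \<open>Here p = 2 and q = 0, so a1 = 0 and b = 0 gives a2 = -1.\<close>
      have "d_t \<beta> (J_ansatz 0 (- 1)) = 0"
        by (simp add: 2 d_t_J_ansatz of_complex_0 base_field_2_neq_0 numeral_poly one_pCons)
      then show ?thesis
        by (auto simp: first_integral_def)
    qed
  qed
qed

end
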